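(* Let $n\ge2$, let $m\ge2$ be even, and let $\mathcal{T}\in\mathbb{S}(\mathbb{R}^n,m)$. Suppose that (a) for every negative eigenvalue $\lambda$ of $\mathcal{T}$, $\mathcal{T}$ possesses a real eigenvector associated with $\lambda$; and (b) all eigenvalues of $\mathcal{T}$ are real. If $\mathcal{T}$ is positive semidefinite, then $$\left[\mathrm{Edet}(\mathcal{E}+\mathcal{T})\right]^{\frac{1}{n(m-1)^{n-1}}}\geq1+\left[\mathrm{Edet}(\mathcal{T})\right]^{\frac{1}{n(m-1)^{n-1}}}.$$
   Context: $\mathbb{S}(\mathbb{R}^n,m)$ is the space of real symmetric $m$-th order $n$-dimensional tensors (entries invariant under permutation of indices). For a tensor $\mathcal{T}=(t_{i_1\ldots i_m})$ and $\mathbf{x}\in\mathbb{C}^n$, $\mathcal{T}\mathbf{x}^{m-1}$ has $i$-th entry $\sum_{i_2,\ldots,i_m=1}^n t_{ii_2\ldots i_m}x_{i_2}\cdots x_{i_m}$. $\mathcal{T}$ is positive semidefinite if $\mathbf{x}^T(\mathcal{T}\mathbf{x}^{m-1})\ge0$ for all $\mathbf{x}\in\mathbb{R}^n$. $\mathcal{E}$ is the identity tensor ($e_{i_1\ldots i_m}=1$ if $i_1=\cdots=i_m$, else $0$). $\lambda\in\mathbb{C}$ is an eigenvalue of $\mathcal{T}$ with eigenvector $\mathbf{x}\in\mathbb{C}^n\setminus\{\mathbf{0}\}$ if $(\lambda\mathcal{E}-\mathcal{T})\mathbf{x}^{m-1}=\mathbf{0}$. The resultant of $n$ homogeneous polynomials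 in $n$ variables, each of degree $m-1$, is the irreducible polynomial in their coefficients that vanishes iff they have a common zero in $\mathbb{C}^n\setminus\{\mathbf{0}\}$, normalized to be $1$ on $(x_1^{m-1},\ldots,x_n^{m-1})$; $\mathrm{Edet}(\mathcal{T})$ is the resultant of the components of $\mathcal{T}\mathbf{x}^{m-1}$. The roots are nonnegative real roots (both E-determinants are nonnegative under the hypotheses). *)

theory Defs
  imports "HOL-Analysis.Analysis" "HOL-Library.Poly_Mapping"
    "HOL-Computational_Algebra.Factorial_Ring"
begin

text \<open>
  An \<open>m\<close>-th order tensor over the index type \<open>'n\<close> (so its dimension is \<open>CARD('n)\<close>) is a function on
  index lists \<open>[i\<^sub>1, \<dots>, i\<^sub>m]\<close>; its values on lists of any other length are irrelevant throughout.
\<close>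

type_synonym ('n, 'a) tensor = "'n list \<Rightarrow> 'a"

definition symmetric_tensor :: "nat \<Rightarrow> ('n, 'a) tensor \<Rightarrow> bool" where
  "symmetric_tensor m T \<longleftrightarrow>
     (\<forall>is js. length is = m \<longrightarrow> mset is = mset js \<longrightarrow> T is = T js)"

definition tensor_apply ::
  "nat \<Rightarrow> ('n::finite, 'a::comm_ring_1) tensor \<Rightarrow> 'a ^ 'n \<Rightarrow> 'a ^ 'n" where
  "tensor_apply m T x =
     (\<chi> i. \<Sum>js | length js = m - 1. T (i # js) * prod_list (map (\<lambda>j. x $ j) js))"

definition id_tensor :: "('n, 'a::zero_neq_one) tensor" where
  "id_tensor is = (if \<exists>i. set is = {i} then 1 else 0)"

definition psd_tensor :: "nat \<Rightarrow> ('n::finite, real) tensor \<Rightarrow> bool" where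
  "psd_tensor m T \<longleftrightarrow> (\<forall>x::real^'n. x \<bullet> tensor_apply m T x \<ge> 0)"

definition eigenpair :: "nat \<Rightarrow> ('n::finite, real) tensor \<Rightarrow> complex \<Rightarrow> complex ^ 'n \<Rightarrow> bool" where
  "eigenpair m T \<mu> x \<longleftrightarrow>
     x \<noteq> 0 \<and> tensor_apply m (\<lambda>is. \<mu> * id_tensor is - complex_of_real (T is)) x = 0"

definition eigenvalue :: "nat \<Rightarrow> ('n::finite, real) tensor \<Rightarrow> complex \<Rightarrow> bool" where
  "eigenvalue m T \<mu> \<longleftrightarrow> (\<exists>x. eigenpair m T \<mu> x)"

text \<open>
  A monomial of degree \<open>d\<close> in variables indexed by \<open>'n\<close> is a multiset over \<open>'n\<close> of size \<open>d\<close>; a form of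
  degree \<open>d\<close> is given by its coefficients \<open>c M\<close> on the monomials \<open>M\<close> of size \<open>d\<close> (other values of \<open>c\<close>
  are ignored).
\<close>

definition form_eval ::
  "nat \<Rightarrow> ('n::finite multiset \<Rightarrow> 'a::comm_ring_1) \<Rightarrow> 'a ^ 'n \<Rightarrow> 'a" where
  "form_eval d c x = (\<Sum>M | size M = d. c M * (\<Prod>j\<in>#M. x $ j))"

text \<open>
  Integer polynomials in the coefficients of a system of forms indexed by \<open>'n\<close>: the indeterminate
  \<open>(i, M)\<close> is the coefficient of the monomial \<open>M\<close> in the \<open>i\<close>-th form. The ring structure is that of
  \<open>Poly_Mapping\<close>.
\<close>

type_synonym 'n coeff_poly = "(('n \<times> 'n multiset) \<Rightarrow>\<^sub>0 nat) \<Rightarrow>\<^sub>0 int"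

definition coeff_poly_eval ::
  "'n coeff_poly \<Rightarrow> ('n \<Rightarrow> 'n multiset \<Rightarrow> 'a::comm_ring_1) \<Rightarrow> 'a" where
  "coeff_poly_eval R F =
     (\<Sum>k\<in>Poly_Mapping.keys R. of_int (Poly_Mapping.lookup R k) *
        (\<Prod>v\<in>Poly_Mapping.keys k. F (fst v) (snd v) ^ Poly_Mapping.lookup k v))"

text \<open>
  The resultant of \<open>CARD('n)\<close> forms of degree \<open>d\<close> in \<open>CARD('n)\<close> variables. For \<open>d \<ge> 1\<close> exactly one
  polynomial satisfies this predicate. The last conjunct normalises its value at the system
  \<open>(x\<^sub>i ^ d)\<^sub>i\<close>.
\<close>

definition is_resultant :: "nat \<Rightarrow> 'n::finite coeff_poly \<Rightarrow> bool" where
  "is_resultant d R \<longleftrightarrow>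
     (\<forall>k\<in>Poly_Mapping.keys R. Poly_Mapping.keys k \<subseteq> {(i, M). size M = d}) \<and>
     irreducible R \<and>
     (\<forall>F :: 'n \<Rightarrow> 'n multiset \<Rightarrow> complex.
        coeff_poly_eval R F = 0 \<longleftrightarrow>
        (\<exists>x :: complex ^ 'n. x \<noteq> 0 \<and> (\<forall>i. form_eval d (F i) x = 0))) \<and>
     coeff_poly_eval R (\<lambda>i M. if M = replicate_mset d i then 1 else 0 :: int) = 1"

text \<open>
  The coefficients of the forms \<open>(T x\<^sup>m\<^sup>-\<^sup>1)\<^sub>i\<close>, after collecting equal monomials.
\<close>

definition tensor_form :: "('n::finite, 'a::comm_ring_1) tensor \<Rightarrow> 'n \<Rightarrow> 'n multiset \<Rightarrow> 'a" where
  "tensor_form T i M = (\<Sum>js | mset js = M. T (i # js))"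

lemma form_eval_tensor_form:
  fixes T :: "('n::finite, 'a::comm_ring_1) tensor"
  shows "form_eval (m - 1) (tensor_form T i) x = tensor_apply m T x $ i"
proof -
  let ?S = "{js :: 'n list. length js = m - 1}"
  let ?g = "\<lambda>js. T (i # js) * prod_list (map (\<lambda>j. x $ j) js)"
  have fin: "finite ?S"
    using finite_lists_length_eq[of "UNIV :: 'n set" "m - 1"] by simp
  have img: "mset ` ?S = {M. size M = m - 1}"
    by (auto simp: image_iff) (metis ex_mset size_mset)
  have fin': "finite {M :: 'n multiset. size M = m - 1}"
    using fin img by (metis finite_imageI)
  have "(\<Sum>js\<in>?S. ?g js) = (\<Sum>M | size M = m - 1. \<Sum>js | js \<in> ?S \<and> mset js = M. ?g js)"
    by (rule sum.group[symmetric]) (use fin fin' img in auto)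
  also have "\<dots> = (\<Sum>M | size M = m - 1. tensor_form T i M * (\<Prod>j\<in>#M. x $ j))"
  proof (rule sum.cong[OF refl])
    fix M :: "'n multiset" assume "M \<in> {M. size M = m - 1}"
    then have "{js. js \<in> ?S \<and> mset js = M} = {js. mset js = M}"
      by (metis (mono_tags, lifting) mem_Collect_eq size_mset)
    then have "(\<Sum>js | js \<in> ?S \<and> mset js = M. ?g js) = (\<Sum>js | mset js = M. ?g js)"
      by (rule arg_cong)
    also have "\<dots> = (\<Sum>js | mset js = M. T (i # js) * (\<Prod>j\<in>#M. x $ j))"
      by (rule sum.cong) (auto simp flip: prod_mset_prod_list)
    finally show "(\<Sum>js | js \<in> ?S \<and> mset js = M. ?g js) = tensor_form T i M * (\<Prod>j\<in>#M. x $ j)"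
      by (simp add: tensor_form_def sum_distrib_right)
  qed
  finally show ?thesis
    by (simp add: form_eval_def tensor_apply_def)
qed

text \<open>
  The E-determinant of an \<open>m\<close>-th order tensor, where \<open>R\<close> is the resultant for degree \<open>m - 1\<close>.
\<close>

definition Edet :: "'n::finite coeff_poly \<Rightarrow> ('n, 'a::comm_ring_1) tensor \<Rightarrow> 'a" where
  "Edet R T = coeff_poly_eval R (tensor_form T)"

end

theory Submission
  imports Defs "HOL-Computational_Algebra.Fundamental_Theorem_Algebra"
begin

text \<open>
  Edet is homogeneous of some degree \<open>K\<close>, so \<open>\<lambda> \<mapsto> Edet (\<lambda> E + T)\<close> is a monic polynomial of degree \<open>K\<close>
  whose roots are the negatives of eigenvalues of \<open>T\<close>; hypotheses (a) and (b) and semidefiniteness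
  make these eigenvalues \<open>\<mu>\<^sub>1, \<dots>, \<mu>\<^sub>K\<close> real and nonnegative. The claim becomes a Minkowski inequality
  for \<open>\<Prod>(1 + \<mu>\<^sub>i)\<close> and \<open>\<Prod>\<mu>\<^sub>i\<close>, a consequence of AM-GM. Since the \<open>N\<close>-th root inequality holds for
  every \<open>N \<le> K\<close>, only the lower bound \<open>n (m - 1) ^ (n - 1) \<le> K\<close> on the degree of the resultant is needed.
\<close>

section \<open>Evaluation of coefficient polynomials\<close>

text \<open>The coefficients of \<open>R\<close> are integers, so evaluation commutes with every
  unital ring homomorphism. This serves evaluation of polynomials at a point and the embeddings of
  the integers and the reals into the complex numbers.\<close>

lemma coeff_poly_eval_hom:
  fixes h :: "'a::comm_ring_1 \<Rightarrow> 'b::comm_ring_1"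
  assumes one: "h 1 = 1" and add: "\<And>a b. h (a + b) = h a + h b"
    and mult: "\<And>a b. h (a * b) = h a * h b"
  shows "h (coeff_poly_eval R F) = coeff_poly_eval R (\<lambda>i M. h (F i M))"
proof -
  have zero: "h 0 = 0" using add[of 0 0] by simp
  have neg: "h (- a) = - h a" for a using add[of a "- a"] zero by (simp add: eq_neg_iff_add_eq_0 add.commute)
  have of_nat: "h (of_nat n) = of_nat n" for n by (induction n) (simp_all add: zero one add)
  have of_int: "h (of_int z) = of_int z" for z
    by (cases z rule: int_cases) (simp_all del: of_nat_Suc add: neg of_nat)
  have sum: "h (sum f A) = (\<Sum>a\<in>A. h (f a))" for f :: "('n \<times> 'n multiset \<Rightarrow>\<^sub>0 nat) \<Rightarrow> 'a" and A
    by (induction A rule: infinite_finite_induct) (simp_all add: zero add)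
  have pow: "h (a ^ n) = h a ^ n" for a n by (induction n) (simp_all add: one mult)
  have prod: "h (prod f A) = (\<Prod>a\<in>A. h (f a))" for f :: "'n \<times> 'n multiset \<Rightarrow> 'a" and A
    by (induction A rule: infinite_finite_induct) (simp_all add: one mult)
  show ?thesis unfolding coeff_poly_eval_def
    by (simp add: sum mult of_int prod pow)
qed

lemma poly_coeff_poly_eval:
  "poly (coeff_poly_eval R F) s = coeff_poly_eval R (\<lambda>i M. poly (F i M) s)"
  by (rule coeff_poly_eval_hom) simp_all

lemma of_real_coeff_poly_eval:
  "(of_real (coeff_poly_eval R F) :: complex) = coeff_poly_eval R (\<lambda>i M. of_real (F i M))"
  by (rule coeff_poly_eval_hom) simp_all

text \<open>Coefficient systems need to be compared in degree \<open>d\<close> only. Thus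
  \<open>tensor_form id_tensor\<close>, which is 1 on \<open>replicate_mset k i\<close> for every
  \<open>k\<close>, can be exchanged for \<open>power_form d\<close>.\<close>

lemma coeff_poly_eval_cong:
  assumes "\<forall>k\<in>Poly_Mapping.keys R. Poly_Mapping.keys k \<subseteq> {(i, M). size M = d}"
    and "\<And>i M. size M = d \<Longrightarrow> F i M = G i M"
  shows "coeff_poly_eval R F = coeff_poly_eval R G"
  unfolding coeff_poly_eval_def
proof (intro sum.cong refl arg_cong2[where f = times] prod.cong)
  fix k v assume "k \<in> Poly_Mapping.keys R" "v \<in> Poly_Mapping.keys k"
  then have "size (snd v) = d" using assms(1) by fastforce
  then show "F (fst v) (snd v) ^ Poly_Mapping.lookup k v = G (fst v) (snd v) ^ Poly_Mapping.lookup k v"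
    by (simp add: assms(2))
qed

lemma finite_size_eq: "finite {M :: 'n::finite multiset. size M = d}"
proof -
  have eq: "{M :: 'n multiset. size M = d} = mset ` {js. set js \<subseteq> UNIV \<and> length js = d}"
    by (auto simp: image_iff) (metis ex_mset size_mset)
  show ?thesis unfolding eq by (intro finite_imageI finite_lists_length_eq finite)
qed

section \<open>Values of explicit forms\<close>

lemma form_eval_single:
  assumes "size N = d"
  shows "form_eval d (\<lambda>M. if M = N then c else 0) x = c * (\<Prod>j\<in>#N. x $ j)"
proof -
  have "form_eval d (\<lambda>M. if M = N then c else 0) x =
      (\<Sum>M | size M = d. if M = N then c * (\<Prod>j\<in>#N. x $ j) else 0)"
    unfolding form_eval_def by (rule sum.cong) simp_all
  then show ?thesis using assms by (simp add: finite_size_eq)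
qed

lemma form_eval_diff: "form_eval d (\<lambda>M. a M - b M) x = form_eval d a x - form_eval d b x"
  by (simp add: form_eval_def left_diff_distrib sum_subtractf)

lemma form_eval_sum: "form_eval d (\<lambda>M. \<Sum>j\<in>J. a j M) x = (\<Sum>j\<in>J. form_eval d (a j) x)"
  unfolding form_eval_def sum_distrib_right by (rule sum.swap)

lemma form_eval_mult: "form_eval d (\<lambda>M. t * a M) x = t * form_eval d a x"
  by (simp add: form_eval_def sum_distrib_left mult.assoc)

definition power_form :: "nat \<Rightarrow> 'n::finite \<Rightarrow> 'n multiset \<Rightarrow> 'a::comm_ring_1" where
  "power_form d i M = (if M = replicate_mset d i then 1 else 0)"

lemma form_eval_power_form [simp]: "form_eval d (power_form d i) x = x $ i ^ d"
  unfolding power_form_def by (subst form_eval_single) simp_all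

section \<open>Complex polynomials\<close>

text \<open>Over the complex numbers the polynomial splits, and here every linear factor is the
  variable itself.\<close>

lemma monom_of_no_nonzero_root:
  fixes p :: "complex poly"
  assumes "\<And>t. t \<noteq> 0 \<Longrightarrow> poly p t \<noteq> 0"
  shows "\<exists>c k. p = monom c k"
proof -
  obtain root where p: "smult (lead_coeff p) (\<Prod>i<degree p. [:-root i, 1:]) = p"
    by (rule complex_poly_decompose')
  have "root i = 0" if "i < degree p" for i
  proof -
    have "poly p (root i) = 0"
      by (subst p[symmetric]) (use that in \<open>auto simp: poly_prod intro!: prod_zero\<close>)
    then show ?thesis using assms by blast
  qed
  then have "p = smult (lead_coeff p) (\<Prod>i<degree p. [:0, 1:])" using p by simp
  also have "\<dots> = monom (lead_coeff p) (degree p)" by (simp add: monom_altdef)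
  finally show ?thesis by blast
qed

text \<open>The polynomial \<open>q\<close> is \<open>r\<close> with its coefficients in reverse
  order, counted down from \<open>k\<close>.\<close>

lemma degree_and_coeff_of_reversed:
  fixes q r :: "complex poly"
  assumes "\<And>s. s \<noteq> 0 \<Longrightarrow> poly q s = s ^ k * poly r (inverse s)"
  shows "degree q \<le> k" and "coeff q k = coeff r 0"
proof -
  let ?e = "degree r"
  \<comment> \<open>The powers of \<open>s\<close> clear the inverse; the extra factor
    \<open>s\<close> on both sides makes the identity hold at 0 as well.\<close>
  have "poly (monom 1 (Suc ?e) * q) s = poly (monom 1 (Suc k) * reflect_poly r) s" for s
    by (cases "s = 0") (simp_all add: poly_monom assms poly_reflect_poly_nz)
  then have eq: "monom 1 (Suc ?e) * q = monom 1 (Suc k) * reflect_poly r"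
    by (simp add: poly_eq_poly_eq_iff[symmetric] fun_eq_iff)
  have c: "coeff q (k + j) = coeff (reflect_poly r) (?e + j)" for j
  proof -
    have "coeff q (k + j) = coeff (monom 1 (Suc ?e) * q) (Suc ?e + k + j)"
      by (simp add: coeff_monom_mult)
    also have "\<dots> = coeff (reflect_poly r) (?e + j)"
      unfolding eq by (simp add: coeff_monom_mult)
    finally show ?thesis .
  qed
  show "degree q \<le> k"
  proof (rule degree_le, intro allI impI)
    fix j assume "k < j"
    then show "coeff q j = 0" using c[of "j - k"] by (simp add: coeff_reflect_poly)
  qed
  show "coeff q k = coeff r 0" using c[of 0] by (simp add: coeff_reflect_poly)
qed

lemma poly_map_poly_poly:
  fixes P :: "complex poly poly"
  shows "poly (map_poly (\<lambda>a. poly a s) P) t = poly (poly P [:t:]) s"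
  by (induction P) (simp_all add: map_poly_pCons)

text \<open>Take \<open>c j = t ^ e j\<close> with distinct exponents \<open>e j\<close>. Two
  different points then collide only when \<open>t\<close> is a root of a nonzero polynomial, and
  finitely many pairs exclude only finitely many \<open>t\<close>.\<close>

lemma separating_linear_form:
  fixes X :: "('n \<Rightarrow> complex) set"
  assumes "finite X" "finite J"
    and sep: "\<And>p p'. p \<in> X \<Longrightarrow> p' \<in> X \<Longrightarrow> (\<And>j. j \<in> J \<Longrightarrow> p j = p' j) \<Longrightarrow> p = p'"
  shows "\<exists>c. inj_on (\<lambda>p. \<Sum>j\<in>J. c j * p j) X"
proof -
  obtain e :: "'n \<Rightarrow> nat" where e: "inj_on e J"
    using finite_imp_inj_to_nat_seg[OF \<open>finite J\<close>] by blast
  define g where "g = (\<lambda>(p, p'). \<Sum>j\<in>J. monom (p j - p' j :: complex) (e j))"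
  define D where "D = {(p, p'). p \<in> X \<and> p' \<in> X \<and> p \<noteq> p'}"
  have "g (p, p') \<noteq> 0" if "(p, p') \<in> D" for p p'
  proof
    assume g0: "g (p, p') = 0"
    have "p l = p' l" if "l \<in> J" for l
    proof -
      have "coeff (g (p, p')) (e l) = (\<Sum>j\<in>J. if j = l then p j - p' j else 0)"
        unfolding g_def prod.case coeff_sum
        by (intro sum.cong refl) (use that in \<open>simp add: inj_on_eq_iff[OF e]\<close>)
      then show ?thesis using \<open>finite J\<close> that g0 by simp
    qed
    then show False using sep that by (auto simp: D_def)
  qed
  moreover have "finite D" by (rule finite_subset[of _ "X \<times> X"]) (auto simp: D_def assms(1))
  ultimately have "finite (\<Union>pp\<in>D. {t. poly (g pp) t = 0})"
    by (auto intro!: poly_roots_finite)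
  then obtain t where t: "\<And>pp. pp \<in> D \<Longrightarrow> poly (g pp) t \<noteq> 0"
    using ex_new_if_finite[OF infinite_UNIV_char_0] by blast
  have "inj_on (\<lambda>p. \<Sum>j\<in>J. t ^ e j * p j) X"
  proof (rule inj_onI, rule ccontr)
    fix p p' assume X: "p \<in> X" "p' \<in> X" "p \<noteq> p'"
      and eq: "(\<Sum>j\<in>J. t ^ e j * p j) = (\<Sum>j\<in>J. t ^ e j * p' j)"
    have "poly (g (p, p')) t = (\<Sum>j\<in>J. t ^ e j * p j) - (\<Sum>j\<in>J. t ^ e j * p' j)"
      unfolding sum_subtractf[symmetric] g_def prod.case poly_sum poly_monom
      by (simp only: left_diff_distrib mult.commute[of _ "t ^ _"] right_diff_distrib)
    then show False using t[of "(p, p')"] X eq by (simp add: D_def)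
  qed
  then show ?thesis by (intro exI[of _ "\<lambda>j. t ^ e j"])
qed

section \<open>Multihomogeneity of the resultant\<close>

definition scale_rows :: "'n set \<Rightarrow> 'a::comm_ring_1 \<Rightarrow> ('n \<Rightarrow> 'n multiset \<Rightarrow> 'a) \<Rightarrow> 'n \<Rightarrow> 'n multiset \<Rightarrow> 'a"
  where "scale_rows S t F i M = (if i \<in> S then t * F i M else F i M)"

context
  fixes d :: nat and R :: "'n::finite coeff_poly"
  assumes res: "is_resultant d R"
begin

lemma resultant_zero_iff:
  "coeff_poly_eval R F = 0 \<longleftrightarrow> (\<exists>x :: complex ^ 'n. x \<noteq> 0 \<and> (\<forall>i. form_eval d (F i) x = 0))"
  using res by (simp add: is_resultant_def)

lemma resultant_power_form [simp]: "coeff_poly_eval R (power_form d) = (1 :: complex)"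
proof -
  have "coeff_poly_eval R (power_form d) = (1 :: int)"
    using res by (simp add: is_resultant_def power_form_def[abs_def])
  moreover have "(of_int (coeff_poly_eval R (power_form d)) :: complex) =
      coeff_poly_eval R (\<lambda>i M. of_int (power_form d i M))"
    by (rule coeff_poly_eval_hom) simp_all
  moreover have "of_int (power_form d i M) = (power_form d i M :: complex)" for i :: 'n and M
    by (simp add: power_form_def)
  ultimately show ?thesis by (simp add: fun_eq_iff)
qed

lemma resultant_scale_zero_iff:
  assumes "t \<noteq> 0"
  shows "coeff_poly_eval R (scale_rows S t F) = (0 :: complex) \<longleftrightarrow> coeff_poly_eval R F = 0"
proof -
  have "form_eval d (scale_rows S t F i) x = (if i \<in> S then t else 1) * form_eval d (F i) x" for i and x :: "complex ^ 'n"
    by (simp add: scale_rows_def[abs_def] form_eval_mult)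
  then have "form_eval d (scale_rows S t F i) x = 0 \<longleftrightarrow> form_eval d (F i) x = 0" for i and x :: "complex ^ 'n"
    using assms by simp
  then show ?thesis by (simp add: resultant_zero_iff)
qed

text \<open>
  Off its zeros, \<open>R\<close> is a nowhere vanishing polynomial in the scaling factor \<open>t \<noteq> 0\<close>, hence a monomial
  in \<open>t\<close>. Along the line from \<open>(x\<^sub>i ^ d)\<^sub>i\<close> to \<open>F\<close> the exponent cannot change, because the product of
  two different coefficients in \<open>t\<close> vanishes at all but finitely many points of the line.
\<close>

lemma resultant_scale_same_exponent:
  fixes F :: "'n \<Rightarrow> 'n multiset \<Rightarrow> complex"
  shows "\<exists>k. \<forall>t. coeff_poly_eval R (scale_rows S t (power_form d)) = t ^ k \<and>
               coeff_poly_eval R (scale_rows S t F) = t ^ k * coeff_poly_eval R F"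
proof -
  define line :: "'n \<Rightarrow> 'n multiset \<Rightarrow> complex poly" where
    "line = (\<lambda>i M. [:power_form d i M, F i M - power_form d i M:])"
  \<comment> \<open>The outer variable is the scaling factor \<open>t\<close>, the inner one the
    position \<open>s\<close> on the line.\<close>
  define P :: "complex poly poly" where
    "P = coeff_poly_eval R (\<lambda>i M. if i \<in> S then [:0, line i M:] else [:line i M:])"
  define b where "b = coeff_poly_eval R line"
  have at: "(\<lambda>i M. poly (line i M) s) = (\<lambda>i M. (1 - s) * power_form d i M + s * F i M)" for s
    by (simp add: line_def fun_eq_iff algebra_simps)
  have P: "poly (poly P [:t:]) s = coeff_poly_eval R (scale_rows S t (\<lambda>i M. poly (line i M) s))" for t s
    unfolding P_def poly_coeff_poly_eval
    by (rule arg_cong[where f = "coeff_poly_eval R"]) (simp add: scale_rows_def fun_eq_iff)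
  have b: "poly b s = coeff_poly_eval R (\<lambda>i M. poly (line i M) s)" for s
    by (simp add: b_def poly_coeff_poly_eval)
  have "poly b 0 = 1" by (simp add: b at)
  then have "b \<noteq> 0" by auto
  have disjoint: "coeff P j = 0 \<or> coeff P l = 0" if "j \<noteq> l" for j l
  proof -
    \<comment> \<open>The factor \<open>b\<close> takes care of the points of the line where
      \<open>R\<close> vanishes. It is 1 at \<open>s = 0\<close>, so it can be cancelled
      afterwards.\<close>
    have "poly (coeff P j * coeff P l * b) s = 0" for s
    proof (cases "poly b s = 0")
      case False
      have "poly (map_poly (\<lambda>a. poly a s) P) t \<noteq> 0" if "t \<noteq> 0" for t
        using False that by (simp add: poly_map_poly_poly P b resultant_scale_zero_iff)
      then obtain c k where "map_poly (\<lambda>a. poly a s) P = monom c k"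
        using monom_of_no_nonzero_root by blast
      then have "poly (coeff P i) s = (if k = i then c else 0)" for i
        by (metis coeff_map_poly coeff_monom poly_0)
      then show ?thesis using that by simp
    qed simp
    then have "coeff P j * coeff P l * b = 0" using poly_all_0_iff_0 by blast
    then show ?thesis using \<open>b \<noteq> 0\<close> by simp
  qed
  have "\<exists>c k. P = monom c k"
  proof (cases "P = 0")
    case True
    then show ?thesis by (intro exI[of _ 0]) simp
  next
    case False
    then have "coeff P (degree P) \<noteq> 0" by simp
    then have "coeff P j = (if degree P = j then lead_coeff P else 0)" for j
      using disjoint[of j "degree P"] by auto
    then show ?thesis by (metis coeff_monom poly_eqI)
  qed
  then obtain c k where "P = monom c k" by blast
  then have hom: "coeff_poly_eval R (scale_rows S t (\<lambda>i M. poly (line i M) s)) = poly c s * t ^ k" for t s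
    by (simp add: P[symmetric] poly_monom)
  have one: "scale_rows S 1 G = G" for G :: "'n \<Rightarrow> 'n multiset \<Rightarrow> complex"
    by (simp add: scale_rows_def fun_eq_iff)
  have "poly c 0 = 1" "poly c 1 = coeff_poly_eval R F"
    using hom[of 1 0] hom[of 1 1] by (simp_all add: at one)
  then show ?thesis
    using hom[of _ 0] hom[of _ 1] by (auto simp: at intro!: exI[of _ k])
qed

lemma resultant_scale:
  "\<exists>k. \<forall>(F :: 'n \<Rightarrow> 'n multiset \<Rightarrow> complex) t.
     coeff_poly_eval R (scale_rows S t F) = t ^ k * coeff_poly_eval R F"
proof -
  obtain k where k: "\<And>t :: complex. coeff_poly_eval R (scale_rows S t (power_form d)) = t ^ k"
    using resultant_scale_same_exponent by blast
  have "coeff_poly_eval R (scale_rows S t F) = t ^ k * coeff_poly_eval R F"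
    for F :: "'n \<Rightarrow> 'n multiset \<Rightarrow> complex" and t
  proof -
    obtain l where l: "\<And>t :: complex. coeff_poly_eval R (scale_rows S t (power_form d)) = t ^ l"
      "\<And>t. coeff_poly_eval R (scale_rows S t F) = t ^ l * coeff_poly_eval R F"
      using resultant_scale_same_exponent[of S F] by blast
    \<comment> \<open>The exponent \<open>l\<close> could depend on \<open>F\<close>; its value on
      the reference system \<open>power_form d\<close>, where \<open>R\<close> is 1, identifies it
      with \<open>k\<close>.\<close>
    have "(of_nat (2 ^ k) :: complex) = of_nat (2 ^ l)"
      using k[of 2] l(1)[of 2] by simp
    then have "k = l" by (simp only: of_nat_eq_iff power_inject_exp)
    then show ?thesis using l(2) by simp
  qed
  then show ?thesis by blast
qed

text \<open>This is the degree of \<open>R\<close> in the coefficients of the \<open>i\<close>-th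
  form. The choice is unambiguous, since \<open>R\<close> is nonzero at
  \<open>power_form d\<close>.\<close>

definition row_degree :: "'n \<Rightarrow> nat" where
  "row_degree i = (SOME k. \<forall>(F :: 'n \<Rightarrow> 'n multiset \<Rightarrow> complex) t.
     coeff_poly_eval R (scale_rows {i} t F) = t ^ k * coeff_poly_eval R F)"

lemma resultant_scale_row:
  fixes F :: "'n \<Rightarrow> 'n multiset \<Rightarrow> complex"
  shows "coeff_poly_eval R (scale_rows {i} t F) = t ^ row_degree i * coeff_poly_eval R F"
  using someI_ex[OF resultant_scale[of "{i}"]] unfolding row_degree_def by blast

lemma resultant_scale_rows:
  fixes F :: "'n \<Rightarrow> 'n multiset \<Rightarrow> complex"
  shows "coeff_poly_eval R (scale_rows S t F) = t ^ (\<Sum>i\<in>S. row_degree i) * coeff_poly_eval R F"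
proof (induction S rule: finite_induct[OF finite])
  case 1
  then show ?case by (simp add: scale_rows_def[abs_def])
next
  case (2 i S)
  have "scale_rows (insert i S) t F = scale_rows {i} t (scale_rows S t F)"
    using 2 by (auto simp: scale_rows_def fun_eq_iff)
  then show ?case using 2 by (simp add: resultant_scale_row power_add)
qed

text \<open>By homogeneity in the rows of \<open>S\<close>, replacing \<open>A + s B\<close> by
  \<open>B + A / s\<close> costs the factor \<open>s\<close> to the total degree in these rows.
  Hence \<open>q\<close> is a reversed polynomial, and its top coefficient is the value at
  \<open>A / s = 0\<close>. It is used for one row and for all rows.\<close>

lemma resultant_pencil:
  fixes A B :: "'n \<Rightarrow> 'n multiset \<Rightarrow> complex" and S :: "'n set"
  defines "q \<equiv> coeff_poly_eval R (\<lambda>i M. if i \<in> S then [:A i M, B i M:] else [:B i M:])"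
  shows "degree q \<le> (\<Sum>i\<in>S. row_degree i)"
    and "coeff q (\<Sum>i\<in>S. row_degree i) = coeff_poly_eval R B"
proof -
  define r where "r = coeff_poly_eval R (\<lambda>i M. if i \<in> S then [:B i M, A i M:] else [:B i M:])"
  have "poly q s = s ^ (\<Sum>i\<in>S. row_degree i) * poly r (inverse s)" if "s \<noteq> 0" for s
  proof -
    have "poly r (inverse s) = coeff_poly_eval R (\<lambda>i M. if i \<in> S then B i M + inverse s * A i M else B i M)"
      unfolding r_def poly_coeff_poly_eval by (simp add: if_distrib[of "\<lambda>p. poly p _"] cong: if_cong)
    moreover have "poly q s = coeff_poly_eval R (\<lambda>i M. if i \<in> S then A i M + s * B i M else B i M)"
      unfolding q_def poly_coeff_poly_eval by (simp add: if_distrib[of "\<lambda>p. poly p _"] cong: if_cong)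
    moreover have "(\<lambda>i M. if i \<in> S then A i M + s * B i M else B i M) =
        scale_rows S s (\<lambda>i M. if i \<in> S then B i M + inverse s * A i M else B i M)"
      using that by (simp add: scale_rows_def fun_eq_iff field_simps)
    ultimately show ?thesis by (simp add: resultant_scale_rows)
  qed
  note rev = degree_and_coeff_of_reversed[OF this]
  show "degree q \<le> (\<Sum>i\<in>S. row_degree i)" by (rule rev(1))
  have "coeff r 0 = coeff_poly_eval R B"
    unfolding poly_0_coeff_0[symmetric] r_def poly_coeff_poly_eval
    by (simp add: if_distrib[of "\<lambda>p. poly p _"] cong: if_cong)
  then show "coeff q (\<Sum>i\<in>S. row_degree i) = coeff_poly_eval R B" using rev(2) by simp
qed


text \<open>
  Fixing the rows \<open>x\<^sub>j ^ d - x\<^sub>i ^ d\<close>, \<open>j \<noteq> i\<close>, and letting row \<open>i\<close> be \<open>L x\<^sub>i ^ (d - 1) - s x\<^sub>i ^ d\<close> for a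
  linear form \<open>L\<close> yields a nonzero polynomial in \<open>s\<close> that vanishes at \<open>L p\<close> for each of the
  \<open>d ^ (n - 1)\<close> points \<open>p\<close> with \<open>p\<^sub>i = 1\<close> whose other entries are \<open>d\<close>-th roots of unity. A generic \<open>L\<close>
  separates these points.
\<close>

lemma row_degree_ge:
  assumes "d > 0"
  shows "d ^ (CARD('n) - 1) \<le> row_degree i"
proof -
  define Z where "Z = {z :: complex. z ^ d = 1}"
  define X where "X = (\<Pi>\<^sub>E j \<in> UNIV - {i}. Z)"
  have finZ: "finite Z" and cardZ: "card Z = d"
    using assms by (simp_all add: Z_def finite_roots_unity card_roots_unity_eq)
  have finX: "finite X" unfolding X_def by (intro finite_PiE) (simp_all add: finZ)
  have cardX: "card X = d ^ (CARD('n) - 1)"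
    unfolding X_def by (simp add: card_PiE cardZ card_Diff_singleton)
  have "\<exists>c. inj_on (\<lambda>p. \<Sum>j\<in>UNIV - {i}. c j * p j) X"
  proof (rule separating_linear_form[OF finX])
    show "p = p'" if "p \<in> X" "p' \<in> X" "\<And>j. j \<in> UNIV - {i} \<Longrightarrow> p j = p' j" for p p'
      using that unfolding X_def by (rule PiE_ext)
  qed simp
  then obtain c where inj: "inj_on (\<lambda>p. \<Sum>j\<in>UNIV - {i}. c j * p j) X" by (rule exE)
  \<comment> \<open>The row index is ignored, because the pencil reads only row \<open>i\<close> of
    \<open>A\<close>.\<close>
  define A :: "'n \<Rightarrow> 'n multiset \<Rightarrow> complex" where
    "A = (\<lambda>_ M. \<Sum>j\<in>UNIV - {i}. c j * (if M = add_mset j (replicate_mset (d - 1) i) then 1 else 0))"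
  define B :: "'n \<Rightarrow> 'n multiset \<Rightarrow> complex" where
    "B = (\<lambda>j M. if j = i then - power_form d i M else power_form d j M - power_form d i M)"
  define q where "q = coeff_poly_eval R (\<lambda>j M. if j \<in> {i} then [:A j M, B j M:] else [:B j M:])"
  have deg: "degree q \<le> row_degree i" and lead: "coeff q (row_degree i) = coeff_poly_eval R B"
    using resultant_pencil[where S = "{i}" and A = A and B = B] by (simp_all add: q_def)
  have evA: "form_eval d (A j) x = (\<Sum>j\<in>UNIV - {i}. c j * x $ j) * x $ i ^ (d - 1)" for j x
    unfolding A_def using assms
    by (simp add: form_eval_sum form_eval_mult form_eval_single sum_distrib_right mult.assoc)
  have evB: "form_eval d (B j) x = (if j = i then - (x $ i ^ d) else x $ j ^ d - x $ i ^ d)" for j x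
    using form_eval_mult[of d "-1" "power_form d i" x] by (simp add: B_def form_eval_diff)
  \<comment> \<open>Row \<open>i\<close> forces the \<open>i\<close>-th coordinate to vanish, and
    then each other row forces its own. So the forms of \<open>B\<close> have no nontrivial common
    zero, and \<open>q\<close> has a nonzero coefficient.\<close>
  have "coeff_poly_eval R B \<noteq> 0"
  proof
    assume "coeff_poly_eval R B = 0"
    then obtain x where "x \<noteq> 0" and x: "\<And>j. form_eval d (B j) x = 0"
      using resultant_zero_iff by blast
    have "x $ i ^ d = 0" using x[of i] by (simp add: evB)
    then have "x $ j = 0" for j using x[of j] assms by (cases "j = i") (simp_all add: evB power_0_left)
    then show False using \<open>x \<noteq> 0\<close> by (simp add: vec_eq_iff)
  qed
  then have "q \<noteq> 0" using lead by auto
  have poly_q: "poly q s = coeff_poly_eval R (\<lambda>j M. if j = i then A i M + s * B i M else B j M)" for s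
    unfolding q_def poly_coeff_poly_eval by (simp add: if_distrib[of "\<lambda>p. poly p _"] cong: if_cong)
  have root: "poly q (\<Sum>j\<in>UNIV - {i}. c j * p j) = 0" (is "poly q ?s = 0") if "p \<in> X" for p
  proof -
    define x :: "complex ^ 'n" where "x = (\<chi> j. if j = i then 1 else p j)"
    have xi: "x $ i = 1" and xj: "x $ j ^ d = 1" for j
      using \<open>p \<in> X\<close> by (auto simp: x_def X_def Z_def PiE_iff)
    have "?s = (\<Sum>j\<in>UNIV - {i}. c j * x $ j)" by (rule sum.cong) (auto simp: x_def)
    then have s: "form_eval d (A i) x = ?s" by (simp only: evA xi power_one mult_1_right)
    \<comment> \<open>Since the \<open>i\<close>-th coordinate is 1, the form of \<open>A\<close>
      takes the value \<open>?s\<close> and that of \<open>B\<close> the value \<open>-1\<close>, so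
      they cancel.\<close>
    have "form_eval d (\<lambda>M. A i M + ?s * B i M) x = form_eval d (A i) x + ?s * form_eval d (B i) x"
      by (simp only: form_eval_def sum.distrib sum_distrib_left distrib_right mult.assoc)
    also have "\<dots> = 0" by (simp add: s evB xi)
    finally have "form_eval d (\<lambda>M. if j = i then A i M + ?s * B i M else B j M) x = 0" for j
      by (cases "j = i") (simp_all add: evB xj)
    moreover have "x \<noteq> 0" using xi by auto
    ultimately show ?thesis unfolding poly_q resultant_zero_iff by (intro exI[of _ x] conjI allI)
  qed
  have "d ^ (CARD('n) - 1) = card ((\<lambda>p. \<Sum>j\<in>UNIV - {i}. c j * p j) ` X)"
    using inj by (simp add: card_image cardX)
  also have "\<dots> \<le> card {s. poly q s = 0}"
    using root \<open>q \<noteq> 0\<close> by (intro card_mono poly_roots_finite) auto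
  also have "\<dots> \<le> degree q" using \<open>q \<noteq> 0\<close> by (rule card_poly_roots_bound)
  finally show ?thesis using deg by simp
qed

end

section \<open>A Minkowski inequality for products\<close>

text \<open>Division by the right-hand side leaves two roots of products of the numbers
  \<open>1 / (1 + \<mu> i)\<close> and \<open>\<mu> i / (1 + \<mu> i)\<close> in [0, 1]. On [0, 1]
  the \<open>N\<close>-th root is at most the \<open>K\<close>-th, AM-GM bounds the latter by the
  mean, and the two means add up to 1.\<close>

lemma one_plus_root_prod_le:
  fixes \<mu> :: "nat \<Rightarrow> real"
  assumes "0 < N" "N \<le> K" and nonneg: "\<And>i. i < K \<Longrightarrow> 0 \<le> \<mu> i"
  shows "1 + root N (\<Prod>i<K. \<mu> i) \<le> root N (\<Prod>i<K. 1 + \<mu> i)"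
proof -
  have mean: "root N (\<Prod>i<K. x i) \<le> (\<Sum>i<K. x i / K)" if x: "\<And>i. i < K \<Longrightarrow> 0 \<le> x i \<and> x i \<le> 1" for x
  proof -
    have p: "0 \<le> (\<Prod>i<K. x i)" "(\<Prod>i<K. x i) \<le> 1"
      using x by (auto intro!: prod_nonneg prod_le_1)
    have "root N (\<Prod>i<K. x i) \<le> root K (\<Prod>i<K. x i)"
    proof (cases "N = K")
      case False
      then show ?thesis using real_root_increasing[of N K] p assms(1,2) by simp
    qed simp
    also have "\<dots> = (\<Prod>i<K. x i) powr (1 / K)"
      using p assms(1,2) by (intro root_powr_inverse) simp_all
    also have "\<dots> \<le> (\<Sum>i<K. x i / K)"
      using arith_geom_mean[of "{..<K}" x] x assms(1,2) by (simp add: lessThan_empty_iff)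
    finally show ?thesis .
  qed
  let ?Q = "\<Prod>i<K. 1 + \<mu> i"
  have pos: "0 < 1 + \<mu> i" if "i < K" for i using nonneg[OF that] by simp
  then have "0 < ?Q" by (auto intro!: prod_pos)
  have "(1 + root N (\<Prod>i<K. \<mu> i)) / root N ?Q = root N (\<Prod>i<K. 1 / (1 + \<mu> i)) + root N (\<Prod>i<K. \<mu> i / (1 + \<mu> i))"
    using assms(1) by (simp add: prod_dividef real_root_divide add_divide_distrib)
  also have "\<dots> \<le> (\<Sum>i<K. 1 / (1 + \<mu> i) / K) + (\<Sum>i<K. \<mu> i / (1 + \<mu> i) / K)"
    using nonneg pos by (intro add_mono mean) (auto simp: divide_le_eq_1)
  also have "\<dots> = (\<Sum>i<K. 1 / K)"
    unfolding sum.distrib[symmetric] add_divide_distrib[symmetric]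
  proof (intro sum.cong refl)
    fix i assume "i \<in> {..<K}"
    then have "1 + \<mu> i \<noteq> 0" using pos[of i] by simp
    then show "(1 + \<mu> i) / (1 + \<mu> i) / K = 1 / K" by simp
  qed
  also have "\<dots> = 1" using assms(1,2) by simp
  finally show ?thesis
    using \<open>0 < ?Q\<close> assms(1) by (metis divide_le_eq_1_pos real_root_gt_zero)
qed

section \<open>Tensors\<close>

lemma tensor_form_id:
  "tensor_form id_tensor i M = (if M = replicate_mset (size M) i then 1 else (0 :: 'a::comm_ring_1))"
proof -
  let ?L = "{js. mset js = M}"
  have fin: "finite ?L"
    by (rule finite_subset[OF _ finite_lists_length_eq[OF finite_set_mset[of M], of "size M"]]) auto
  have "id_tensor (i # js) = (if js = replicate (size M) i then 1 else (0 :: 'a))" if "js \<in> ?L" for js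
  proof -
    have "(\<exists>k. set (i # js) = {k}) \<longleftrightarrow> (\<forall>j\<in>set js. j = i)"
      by (simp add: insert_eq_iff) blast
    also have "\<dots> \<longleftrightarrow> js = replicate (length js) i"
      by (induction js) auto
    also have "length js = size M" using that by auto
    finally show ?thesis by (simp add: id_tensor_def)
  qed
  then have "tensor_form id_tensor i M = (\<Sum>js\<in>?L. if js = replicate (size M) i then 1 else (0 :: 'a))"
    unfolding tensor_form_def by (intro sum.cong refl)
  also have "\<dots> = (if replicate (size M) i \<in> ?L then 1 else 0)"
    using fin by (rule sum.delta)
  finally show ?thesis by (auto simp: eq_commute)
qed

lemma tensor_form_pencil:
  "tensor_form (\<lambda>is. \<mu> * id_tensor is + T is) i M = tensor_form T i M + \<mu> * tensor_form id_tensor i M"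
  by (simp add: tensor_form_def sum.distrib sum_distrib_left)

lemma tensor_apply_add:
  "tensor_apply m (\<lambda>is. \<mu> * S is + T is) x = \<mu> *s tensor_apply m S x + tensor_apply m T x"
  by (simp add: tensor_apply_def vec_eq_iff sum.distrib sum_distrib_left distrib_right mult.assoc)

lemma tensor_apply_diff:
  "tensor_apply m (\<lambda>is. \<mu> * S is - T is) x = \<mu> *s tensor_apply m S x - tensor_apply m T x"
  by (simp add: tensor_apply_def vec_eq_iff sum_subtractf sum_distrib_left left_diff_distrib mult.assoc)

lemma tensor_apply_id: "tensor_apply m id_tensor x $ i = x $ i ^ (m - 1)"
proof -
  have "tensor_apply m id_tensor x $ i = form_eval (m - 1) (power_form (m - 1) i) x"
    unfolding form_eval_tensor_form[symmetric] form_eval_def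
    by (rule sum.cong) (auto simp: tensor_form_id power_form_def)
  then show ?thesis by simp
qed

lemma tensor_apply_of_real:
  "tensor_apply m (\<lambda>is. complex_of_real (T is)) (\<chi> i. complex_of_real (x $ i)) =
   (\<chi> i. complex_of_real (tensor_apply m T x $ i))"
proof -
  have "complex_of_real (prod_list (map f js)) = prod_list (map (\<lambda>j. complex_of_real (f j)) js)"
    for f :: "'a \<Rightarrow> real" and js by (induction js) simp_all
  then show ?thesis by (simp add: tensor_apply_def vec_eq_iff)
qed

text \<open>Pairing the eigenvalue equation with \<open>x\<close> gives \<open>\<mu>\<close> times
  the sum of the \<open>m\<close>-th powers of the entries of \<open>x\<close>, which is positive
  for even \<open>m\<close>.\<close>

lemma psd_real_eigenvalue_nonneg:
  fixes T :: "('n::finite, real) tensor"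
  assumes "even m" "m > 0" and psd: "psd_tensor m T"
    and eig: "eigenpair m T (complex_of_real \<mu>) (\<chi> i. complex_of_real (x $ i))"
  shows "\<mu> \<ge> 0"
proof (rule ccontr)
  assume "\<not> \<mu> \<ge> 0"
  have "complex_of_real (tensor_apply m T x $ i) = complex_of_real (\<mu> * x $ i ^ (m - 1))" for i
    using eig by (simp add: eigenpair_def tensor_apply_diff tensor_apply_of_real vec_eq_iff tensor_apply_id)
  then have "tensor_apply m T x $ i = \<mu> * x $ i ^ (m - 1)" for i
    by (simp only: of_real_eq_iff)
  then have "x \<bullet> tensor_apply m T x = (\<Sum>i\<in>UNIV. x $ i * (\<mu> * x $ i ^ (m - 1)))"
    by (simp add: inner_vec_def)
  also have "\<dots> = \<mu> * (\<Sum>i\<in>UNIV. x $ i ^ m)"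
    unfolding sum_distrib_left
    by (rule sum.cong) (simp_all add: power_eq_if[of _ m] \<open>m > 0\<close>[THEN gr_implies_not0])
  finally have "0 \<le> \<mu> * (\<Sum>i\<in>UNIV. x $ i ^ m)" using psd by (metis psd_tensor_def)
  moreover obtain i where "x $ i \<noteq> 0"
    using eig by (auto simp: eigenpair_def vec_eq_iff)
  then have "0 < (\<Sum>i\<in>UNIV. x $ i ^ m)"
    using \<open>even m\<close> by (intro sum_pos2[of _ i]) (auto simp: zero_le_even_power zero_less_power_eq)
  ultimately show False using \<open>\<not> \<mu> \<ge> 0\<close> by (simp add: zero_le_mult_iff)
qed

text \<open>With \<open>K\<close> the total degree of \<open>R\<close>, the polynomial
  \<open>\<phi>\<close> is monic of degree \<open>K\<close>, because its coefficient at
  \<open>K\<close> is the value of \<open>R\<close> at the identity tensor. A root of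
  \<open>\<phi>\<close> yields a common zero of the forms, that is, an eigenvector for the negated
  root.\<close>

lemma Edet_pencil_factorization:
  fixes T :: "('n::finite, real) tensor"
  assumes res: "is_resultant (m - 1) R" and "m \<ge> 2"
  obtains K and \<mu> :: "nat \<Rightarrow> complex"
  where "CARD('n) * (m - 1) ^ (CARD('n) - 1) \<le> K" "\<And>i. i < K \<Longrightarrow> eigenvalue m T (\<mu> i)"
    "\<And>t. complex_of_real (Edet R (\<lambda>is. t * id_tensor is + T is)) = (\<Prod>i<K. complex_of_real t + \<mu> i)"
proof -
  define T' where "T' = (\<lambda>is. complex_of_real (T is))"
  define K where "K = (\<Sum>i\<in>UNIV. row_degree R i)"
  \<comment> \<open>The vacuous case distinction matches the shape of
    \<open>resultant_pencil\<close> for \<open>S = UNIV\<close>.\<close>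
  define \<phi> where "\<phi> = coeff_poly_eval R
    (\<lambda>i M. if i \<in> UNIV then [:tensor_form T' i M, tensor_form id_tensor i M:] else [:tensor_form id_tensor i M:])"
  have \<phi>: "poly \<phi> t = Edet R (\<lambda>is. t * id_tensor is + T' is)" for t
    unfolding \<phi>_def Edet_def poly_coeff_poly_eval by (simp add: tensor_form_pencil[abs_def])
  have "coeff_poly_eval R (tensor_form id_tensor) = coeff_poly_eval R (power_form (m - 1) :: 'n \<Rightarrow> 'n multiset \<Rightarrow> complex)"
    using res by (intro coeff_poly_eval_cong[of _ "m - 1"])
      (auto simp: is_resultant_def tensor_form_id power_form_def)
  then have "degree \<phi> \<le> K" "coeff \<phi> K = 1"
    using resultant_pencil[OF res, where S = UNIV and A = "tensor_form T'" and B = "tensor_form id_tensor"]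
    unfolding resultant_power_form[OF res] by (simp_all add: \<phi>_def K_def)
  moreover from this have "degree \<phi> = K" by (intro antisym le_degree) simp_all
  moreover obtain r where "smult (lead_coeff \<phi>) (\<Prod>i<degree \<phi>. [:- r i, 1:]) = \<phi>"
    by (rule complex_poly_decompose')
  ultimately have r: "\<phi> = (\<Prod>i<K. [:- r i, 1:])" by simp
  have le: "(\<Sum>i\<in>(UNIV :: 'n set). (m - 1) ^ (CARD('n) - 1)) \<le> K"
    unfolding K_def using \<open>m \<ge> 2\<close> by (intro sum_mono row_degree_ge[OF res]) simp
  have eig: "eigenvalue m T (- r i)" if "i < K" for i
  proof -
    have "poly \<phi> (r i) = 0"
      unfolding r poly_prod using that by (intro prod_zero) auto
    then obtain x where "x \<noteq> 0" and
      x: "\<And>j. form_eval (m - 1) (tensor_form (\<lambda>is. r i * id_tensor is + T' is) j) x = 0"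
      unfolding \<phi> Edet_def resultant_zero_iff[OF res] by blast
    have "tensor_apply m (\<lambda>is. r i * id_tensor is + T' is) x = 0"
      unfolding vec_eq_iff form_eval_tensor_form[symmetric] by (simp only: x zero_index simp_thms)
    then have "tensor_apply m (\<lambda>is. - r i * id_tensor is - T' is) x = 0"
      unfolding tensor_apply_add tensor_apply_diff by (simp add: vec_eq_iff neg_eq_iff_add_eq_0)
    then show ?thesis
      using \<open>x \<noteq> 0\<close> by (auto simp: eigenvalue_def eigenpair_def T'_def)
  qed
  have Edet: "complex_of_real (Edet R (\<lambda>is. t * id_tensor is + T is)) = (\<Prod>i<K. complex_of_real t + - r i)" for t
  proof -
    have "complex_of_real (id_tensor is) = id_tensor is" for "is" :: "'n list"
      by (simp add: id_tensor_def)
    then have "complex_of_real (Edet R (\<lambda>is. t * id_tensor is + T is)) = poly \<phi> (of_real t)"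
      unfolding \<phi> Edet_def of_real_coeff_poly_eval by (simp add: tensor_form_def[abs_def] T'_def)
    also have "\<dots> = (\<Prod>i<K. complex_of_real t + - r i)"
      unfolding r by (simp add: poly_prod)
    finally show ?thesis .
  qed
  show thesis by (rule that[of K "\<lambda>i. - r i", OF _ eig Edet]) (use le in simp_all)
qed

section \<open>Nonnegativity of the eigenvalues and the root inequality\<close>

theorem proposition10p2:
  fixes T :: "('n::finite, real) tensor"
    and m :: nat
    and R :: "'n coeff_poly"
  assumes dim: "CARD('n) \<ge> 2"
    and order: "m \<ge> 2" "even m"
    and res: "is_resultant (m - 1) R"
    and sym: "symmetric_tensor m T"
    and neg_real_eigenvector:
      "\<And>\<mu> :: real. \<mu> < 0 \<Longrightarrow> eigenvalue m T (complex_of_real \<mu>) \<Longrightarrow>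
         \<exists>x :: real ^ 'n. eigenpair m T (complex_of_real \<mu>) (\<chi> i. complex_of_real (x $ i))"
    and real_eigenvalues: "\<And>\<mu> :: complex. eigenvalue m T \<mu> \<Longrightarrow> \<mu> \<in> \<real>"
    and psd: "psd_tensor m T"
  shows "root (CARD('n) * (m - 1) ^ (CARD('n) - 1)) (Edet R (\<lambda>is. id_tensor is + T is))
           \<ge> 1 + root (CARD('n) * (m - 1) ^ (CARD('n) - 1)) (Edet R T)"
proof -
  obtain K and \<mu> :: "nat \<Rightarrow> complex" where K: "CARD('n) * (m - 1) ^ (CARD('n) - 1) \<le> K"
    and eig: "\<And>i. i < K \<Longrightarrow> eigenvalue m T (\<mu> i)"
    and Edet: "\<And>t. complex_of_real (Edet R (\<lambda>is. t * id_tensor is + T is)) = (\<Prod>i<K. complex_of_real t + \<mu> i)"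
    using Edet_pencil_factorization[OF res order(1)] by metis
  have real: "\<mu> i = complex_of_real (Re (\<mu> i))" if "i < K" for i
    using real_eigenvalues[OF eig[OF that]] by (simp add: of_real_Re)
  have nonneg: "0 \<le> Re (\<mu> i)" if i: "i < K" for i
  proof (rule ccontr)
    assume neg: "\<not> 0 \<le> Re (\<mu> i)"
    then obtain x where "eigenpair m T (complex_of_real (Re (\<mu> i))) (\<chi> i. complex_of_real (x $ i))"
      using neg_real_eigenvector[of "Re (\<mu> i)"] eig[OF i] real[OF i] by auto
    then show False
      using psd_real_eigenvalue_nonneg[OF order(2) _ psd] order(1) neg by auto
  qed
  have Edet_real: "Edet R (\<lambda>is. t * id_tensor is + T is) = (\<Prod>i<K. t + Re (\<mu> i))" for t
  proof -
    have "complex_of_real (Edet R (\<lambda>is. t * id_tensor is + T is)) = complex_of_real (\<Prod>i<K. t + Re (\<mu> i))"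
      unfolding Edet of_real_prod by (rule prod.cong) (simp_all add: real[symmetric])
    then show ?thesis by (simp only: of_real_eq_iff)
  qed
  \<comment> \<open>The pencil is the tensor \<open>E + T\<close> at \<open>t = 1\<close> and
    \<open>T\<close> itself at \<open>t = 0\<close>.\<close>
  show ?thesis
    using one_plus_root_prod_le[OF _ K nonneg] Edet_real[of 1] Edet_real[of 0] order(1) by simp
qed

end
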